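(* Let $G$ be a graph and let $\ell$ be an integer with $0\le \ell\le |V(G)|$. A set $B\subseteq V(G)$ is an $\ell$-leaky positive semidefinite forcing set of $G$ if and only if $B\cap F\neq\varnothing$ for every $\ell$-leaky positive semidefinite fort $F$ of $G$.
   Context: All graphs are finite, simple and undirected. Positive semidefinite (psd) color change rule: given the current set $B$ of blue vertices of a graph $G$, let $W_1,\dots,W_k$ be the vertex sets of the connected components of $G-B$. If $u\in B$ and $w\in W_i$ is the only non-blue neighbor of $u$ in the induced subgraph $G[W_i\cup B]$, then $u$ may force $w$ (written $u\to w$), and $w$ becomes blue. The rule is applied iteratively, with the components recomputed from the current blue set. A leak is a vertex that is not allowed to perform any force. For $0\le \ell\le |V(G)|$, a set $B\subseteq V(G)$ is an $\ell$-leaky positive semidefinite forcing set of $G$ if, for every choice of $\ell$ vertices as leaks (chosen after $B$ is fixed; leaks may be inside or outside $B$), starting with exactly $B$ blue, iterated application of the psd color change rule, with forces performed only by non-leak vertices, colors all of $V(G)$ blue. An $\ell$-leaky positive semidefinite fort of $G$ is a nonempty subset $F\subseteq V(G)$ such that, for each connected component (with vertex set) $F_i$ of the induced subgraph $G[F]$ and for each $v\notin F$, either $|N_G(v)\cap F_i|=0$, or $|N_G(v)\cap F_i|\ge 2$, or $|\{x\in V(G)\setminus F : |N_G(x)\cap F_i|=1\}|\le \ell$. Equivalently, for each component $F_i$ of $G[F]$, at most $\ell$ vertices outside $F$ have exactly one neighbor in $F_i$. *)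

theory Defs
  imports "Graph_Theory.Digraph_Component"
begin

text \<open>
  Finite simple undirected graphs are the members of the locale \<^locale>\<open>graph\<close>: finite,
  loop-free, symmetric digraphs without parallel arcs, so that an undirected edge is a pair of
  opposite arcs. The null graph is included.
\<close>

definition neighbors :: "('a, 'b) pre_digraph \<Rightarrow> 'a \<Rightarrow> 'a set" where
  "neighbors G v = {w. v \<rightarrow>\<^bsub>G\<^esub> w}"

text \<open>
  In a symmetric digraph the strongly connected components are exactly the connected components
  of the underlying undirected graph.
\<close>

definition component_verts :: "('a, 'b) pre_digraph \<Rightarrow> 'a set set" where
  "component_verts G = pre_digraph.sccs_verts G"

definition psd_force :: "('a, 'b) pre_digraph \<Rightarrow> 'a set \<Rightarrow> 'a \<Rightarrow> 'a \<Rightarrow> bool" where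
  "psd_force G B u w \<longleftrightarrow>
     u \<in> B \<and>
     (\<exists>W \<in> component_verts (G \<restriction> (verts G - B)).
        w \<in> W \<and> neighbors (G \<restriction> (W \<union> B)) u - B = {w})"

inductive leaky_psd_step ::
  "('a, 'b) pre_digraph \<Rightarrow> 'a set \<Rightarrow> 'a set \<Rightarrow> 'a set \<Rightarrow> bool" for G L where
  "u \<notin> L \<Longrightarrow> psd_force G B u w \<Longrightarrow> leaky_psd_step G L B (insert w B)"

text \<open>
  An available force stays available while its target is not blue, so the order of the
  forces does not matter: asking for some sequence of forces that colours every vertex is the
  same as asking that every exhaustive sequence does.
\<close>

definition leaky_psd_forcing_set :: "nat \<Rightarrow> ('a, 'b) pre_digraph \<Rightarrow> 'a set \<Rightarrow> bool" where
  "leaky_psd_forcing_set l G B \<longleftrightarrow>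
     B \<subseteq> verts G \<and>
     (\<forall>L. L \<subseteq> verts G \<and> card L = l \<longrightarrow> (leaky_psd_step G L)\<^sup>*\<^sup>* B (verts G))"

definition leaky_psd_fort :: "nat \<Rightarrow> ('a, 'b) pre_digraph \<Rightarrow> 'a set \<Rightarrow> bool" where
  "leaky_psd_fort l G F \<longleftrightarrow>
     F \<noteq> {} \<and> F \<subseteq> verts G \<and>
     (\<forall>C \<in> component_verts (G \<restriction> F). \<forall>v \<in> verts G - F.
        card (neighbors G v \<inter> C) = 0 \<or>
        card (neighbors G v \<inter> C) \<ge> 2 \<or>
        card {x \<in> verts G - F. card (neighbors G x \<inter> C) = 1} \<le> l)"

end

theory Submission
  imports Defs
begin

text \<open>
  A component of a fort has no neighbours in the rest of the fort, so at most \<open>l\<close> vertices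
  outside the component have exactly one neighbour in it. If all of them leak and the component
  starts out white, then it stays inside one white component and its first vertex to be forced
  would have to be forced by one of the leaks. Conversely, if the forcing process gets stuck,
  then every vertex with exactly one neighbour in some white component is a leak, so the set of
  white vertices is a fort.
\<close>

lemma neighbors_induce_subgraph:
  "neighbors (G \<restriction> S) u = (if u \<in> S then neighbors G u \<inter> S else {})"
  by (auto simp: neighbors_def arcs_ends_def arc_to_ends_def)

lemma (in wf_digraph) component_verts_induce_subset:
  assumes "C \<in> component_verts (G \<restriction> S)"
  shows "C \<subseteq> S"
  using wf_digraph.sccs_verts_subsets[OF wellformed_induce_subgraph] assms
  by (fastforce simp: component_verts_def)

text \<open>Vertices of \<open>C\<close> reach each other by walks that stay inside
  \<open>C\<close>, and such walks survive in any induced subgraph containing \<open>C\<close>.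
  Neither of \<open>S\<close> and \<open>T\<close> has to contain the other: below, \<open>S\<close>
  is a fort and \<open>T\<close> the current white set, while other parts of the fort may already be
  blue.\<close>

lemma (in wf_digraph) component_verts_induce_subset_component:
  assumes C: "C \<in> component_verts (G \<restriction> S)" and W: "W \<in> component_verts (G \<restriction> T)"
    and "C \<subseteq> T" and "w \<in> C" "w \<in> W"
  shows "C \<subseteq> W"
proof
  fix v assume "v \<in> C"
  interpret GS: max_reachable_set "G \<restriction> S" C
    using C by (auto simp: component_verts_def max_reachable_set_def max_reachable_set_axioms_def)
  have eq: "(G \<restriction> S) \<restriction> C = G \<restriction> C"
    using component_verts_induce_subset[OF C] by (auto simp: induce_subgraph_def)
  have "x \<rightarrow>\<^sup>*\<^bsub>G \<restriction> T\<^esub> y" if "x \<in> C" "y \<in> C" for x y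
    using GS.reachable_induced[OF that GS.reach_in[OF that]] \<open>C \<subseteq> T\<close>
    unfolding eq by (rule reachable_induce_ss)
  then have "w \<rightarrow>\<^sup>*\<^bsub>G \<restriction> T\<^esub> v" "v \<rightarrow>\<^sup>*\<^bsub>G \<restriction> T\<^esub> w"
    using \<open>v \<in> C\<close> \<open>w \<in> C\<close> by auto
  then show "v \<in> W"
    using W \<open>w \<in> W\<close> unfolding component_verts_def pre_digraph.sccs_verts_def by blast
qed

lemma (in sym_digraph) neighbors_component_closed:
  assumes F: "F \<subseteq> verts G" and C: "C \<in> component_verts (G \<restriction> F)"
    and "v \<in> F" and w: "w \<in> C" "w \<in> neighbors G v"
  shows "v \<in> C"
proof -
  interpret GF: wf_digraph "G \<restriction> F" ..
  have "w \<in> F"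
    using component_verts_induce_subset[OF C] w by auto
  have "v \<in> neighbors G w"
    using w graph_symmetric by (auto simp: neighbors_def)
  then have "v \<in> neighbors (G \<restriction> F) w" "w \<in> neighbors (G \<restriction> F) v"
    using w \<open>v \<in> F\<close> \<open>w \<in> F\<close> by (auto simp: neighbors_induce_subgraph)
  then have "v \<rightarrow>\<^sup>*\<^bsub>G \<restriction> F\<^esub> w" "w \<rightarrow>\<^sup>*\<^bsub>G \<restriction> F\<^esub> v"
    by (auto simp: neighbors_def)
  then show ?thesis
    using C w unfolding component_verts_def pre_digraph.sccs_verts_def by blast
qed

text \<open>A vertex counted by the set refutes the first two alternatives at itself, which leaves
  the bound; if nothing is counted, the cardinality is 0.\<close>

lemma leaky_psd_fort_iff:
  "leaky_psd_fort l G F \<longleftrightarrow>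
     F \<noteq> {} \<and> F \<subseteq> verts G \<and>
     (\<forall>C \<in> component_verts (G \<restriction> F).
        card {x \<in> verts G - F. card (neighbors G x \<inter> C) = 1} \<le> l)"
proof -
  have "card {x \<in> verts G - F. card (neighbors G x \<inter> C) = 1} \<le> l"
    if "\<forall>v \<in> verts G - F. card (neighbors G v \<inter> C) = 0 \<or> card (neighbors G v \<inter> C) \<ge> 2 \<or>
      card {x \<in> verts G - F. card (neighbors G x \<inter> C) = 1} \<le> l" for C
  proof (cases "{x \<in> verts G - F. card (neighbors G x \<inter> C) = 1} = {}")
    case False
    then show ?thesis using that by force
  qed (simp only: card.empty)
  then show ?thesis
    unfolding leaky_psd_fort_def by blast
qed

text \<open>This is the invariant of the forcing process. It concerns the single component
  \<open>C\<close>, since the rest of \<open>F\<close> may well turn blue.\<close>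

lemma (in sym_digraph) leaky_psd_step_avoids_component:
  assumes F: "F \<subseteq> verts G" and C: "C \<in> component_verts (G \<restriction> F)"
    and L: "{x \<in> verts G - F. card (neighbors G x \<inter> C) = 1} \<subseteq> L"
    and step: "leaky_psd_step G L B B'" and "B \<inter> C = {}"
  shows "B' \<inter> C = {}"
  using step
proof cases
  case (1 u w)
  have "w \<notin> C"
  proof
    assume "w \<in> C"
    obtain W where W: "u \<in> B" "W \<in> component_verts (G \<restriction> (verts G - B))" "w \<in> W"
      and nb: "neighbors (G \<restriction> (W \<union> B)) u - B = {w}"
      using 1 unfolding psd_force_def by blast
    have "C \<subseteq> verts G - B"
      using component_verts_induce_subset[OF C] F \<open>B \<inter> C = {}\<close> by auto
    then have "C \<subseteq> W"
      using component_verts_induce_subset_component[OF C W(2)] \<open>w \<in> C\<close> W by auto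
    \<comment> \<open>All of \<open>C\<close> is white and lies in \<open>W\<close>, so every
      neighbor of \<open>u\<close> in \<open>C\<close> competes with \<open>w\<close> for the
      force.\<close>
    then have one: "neighbors G u \<inter> C = {w}"
      using nb W(1) \<open>w \<in> C\<close> \<open>B \<inter> C = {}\<close>
      by (auto simp: neighbors_induce_subgraph)
    moreover have "u \<in> verts G"
      using one adj_in_verts by (auto simp: neighbors_def)
    \<comment> \<open>If \<open>u\<close> were in \<open>F\<close>, its neighbor \<open>w\<close>
      would pull it into \<open>C\<close>, but \<open>u\<close> is blue.\<close>
    moreover have "u \<notin> F"
      using neighbors_component_closed[OF F C _ \<open>w \<in> C\<close>] one W(1) \<open>B \<inter> C = {}\<close> by blast
    ultimately have "u \<in> L" using L by auto
    then show False using 1 by simp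
  qed
  then show ?thesis using 1 \<open>B \<inter> C = {}\<close> by simp
qed

lemma (in graph) leaky_psd_forcing_set_meets_fort:
  assumes l: "l \<le> card (verts G)" and B: "leaky_psd_forcing_set l G B"
    and fort: "leaky_psd_fort l G F"
  shows "B \<inter> F \<noteq> {}"
proof
  assume disj: "B \<inter> F = {}"
  have F: "F \<noteq> {}" "F \<subseteq> verts G" using fort by (auto simp: leaky_psd_fort_iff)
  interpret GF: wf_digraph "G \<restriction> F" ..
  obtain v where "v \<in> F" using F by auto
  define C where "C = pre_digraph.scc_of (G \<restriction> F) v"
  have C: "C \<in> component_verts (G \<restriction> F)" "v \<in> C"
    using \<open>v \<in> F\<close> GF.scc_of_in_sccs_verts GF.in_scc_of_self
    by (auto simp: C_def component_verts_def)
  let ?S = "{x \<in> verts G - F. card (neighbors G x \<inter> C) = 1}"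
  have "card ?S \<le> l" using fort C(1) unfolding leaky_psd_fort_iff by blast
  \<comment> \<open>The dangerous vertices are padded to exactly \<open>l\<close> leaks; there is
    room because \<open>l\<close> \<le> \<open>card (verts G)\<close>.\<close>
  then obtain L where L: "?S \<subseteq> L" "L \<subseteq> verts G" "card L = l"
    using exists_subset_between[of ?S l "verts G"] l by auto
  then have "(leaky_psd_step G L)\<^sup>*\<^sup>* B (verts G)"
    using B by (simp add: leaky_psd_forcing_set_def)
  then have "verts G \<inter> C = {}"
  proof induction
    case base
    then show ?case using disj component_verts_induce_subset[OF C(1)] by auto
  next
    case (step Y Z)
    then show ?case using leaky_psd_step_avoids_component[OF F(2) C(1) L(1)] by blast
  qed
  then show False using C(2) F \<open>v \<in> F\<close> by auto
qed

lemma (in wf_digraph) leaky_psd_step_subset_verts: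
  assumes "leaky_psd_step G L B B'" and "B \<subseteq> verts G"
  shows "B' \<subseteq> verts G"
  using assms
  by cases (use component_verts_induce_subset in \<open>fastforce simp: psd_force_def\<close>)

text \<open>A force always turns a white vertex blue, so \<open>stuck\<close> says that no force by
  a non-leak is left. The vertices outside the white set are just those of \<open>X\<close>.\<close>

lemma (in fin_digraph) stuck_complement_leaky_psd_fort:
  assumes X: "X \<subseteq> verts G" "X \<noteq> verts G" and L: "L \<subseteq> verts G" "card L \<le> l"
    and stuck: "\<And>Y. leaky_psd_step G L X Y \<Longrightarrow> Y = X"
  shows "leaky_psd_fort l G (verts G - X)"
  unfolding leaky_psd_fort_iff
proof (intro conjI ballI)
  fix C assume C: "C \<in> component_verts (G \<restriction> (verts G - X))"
  then have sub: "C \<subseteq> verts G - X" by (rule component_verts_induce_subset)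
  have "{x \<in> verts G - (verts G - X). card (neighbors G x \<inter> C) = 1} \<subseteq> L"
  proof (rule subsetI, rule ccontr)
    fix x assume x: "x \<in> {x \<in> verts G - (verts G - X). card (neighbors G x \<inter> C) = 1}"
      and "x \<notin> L"
    then obtain w where w: "neighbors G x \<inter> C = {w}" by (auto simp: card_1_singleton_iff)
    \<comment> \<open>\<open>C\<close> itself serves as the white component: removing
      \<open>X\<close> from the neighbors of \<open>x\<close> within \<open>C\<close> \<union>
      \<open>X\<close> leaves those in \<open>C\<close>.\<close>
    then have "psd_force G X x w"
      unfolding psd_force_def using x C sub
      by (auto simp: neighbors_induce_subgraph intro!: bexI[of _ C])
    then have "insert w X = X" using \<open>x \<notin> L\<close> stuck leaky_psd_step.intros by metis
    then show False using w sub by auto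
  qed
  moreover have "finite L" using L finite_verts finite_subset by blast
  ultimately show "card {x \<in> verts G - (verts G - X). card (neighbors G x \<inter> C) = 1} \<le> l"
    using L card_mono by (meson le_trans)
qed (use X in auto)

lemma (in fin_digraph) leaky_psd_forcing_set_if_meets_forts:
  assumes B: "B \<subseteq> verts G" and forts: "\<And>F. leaky_psd_fort l G F \<Longrightarrow> B \<inter> F \<noteq> {}"
  shows "leaky_psd_forcing_set l G B"
  unfolding leaky_psd_forcing_set_def
proof (intro conjI allI impI B)
  fix L assume L: "L \<subseteq> verts G \<and> card L = l"
  let ?R = "{X. (leaky_psd_step G L)\<^sup>*\<^sup>* B X}"
  have sub: "X \<subseteq> verts G" if "(leaky_psd_step G L)\<^sup>*\<^sup>* B X" for X
    using that by induction (use B leaky_psd_step_subset_verts in auto)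
  then have "finite ?R" by (auto intro!: finite_subset[of ?R "Pow (verts G)"])
  \<comment> \<open>An inclusion-maximal blue set among the finitely many reachable ones stands for
    the end of an exhaustive run; steps only enlarge the blue set, so none can leave it.\<close>
  then obtain X where X: "X \<in> ?R" "B \<subseteq> X" and max: "\<forall>Y \<in> ?R. X \<subseteq> Y \<longrightarrow> X = Y"
    using finite_has_maximal2[of ?R B] by auto
  have stuck: "Y = X" if "leaky_psd_step G L X Y" for Y
  proof -
    have "X \<subseteq> Y" using that by cases auto
    moreover have "Y \<in> ?R" using X that by auto
    ultimately show ?thesis using max by auto
  qed
  have "X = verts G"
  proof (rule ccontr)
    assume "X \<noteq> verts G"
    then have "leaky_psd_fort l G (verts G - X)"
      using stuck_complement_leaky_psd_fort[of X L l] stuck sub[of X] X L by blast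
    \<comment> \<open>The white set is a fort that misses \<open>X\<close>, hence also
      \<open>B\<close>.\<close>
    then show False using forts X(2) by blast
  qed
  then show "(leaky_psd_step G L)\<^sup>*\<^sup>* B (verts G)" using X by simp
qed

theorem theorem34:
  fixes G :: "('a, 'b) pre_digraph" and l :: nat and B :: "'a set"
  assumes "graph G" and "l \<le> card (verts G)" and "B \<subseteq> verts G"
  shows "leaky_psd_forcing_set l G B \<longleftrightarrow> (\<forall>F. leaky_psd_fort l G F \<longrightarrow> B \<inter> F \<noteq> {})"
proof -
  interpret graph G by fact
  show ?thesis
    using leaky_psd_forcing_set_meets_fort leaky_psd_forcing_set_if_meets_forts assms by blast
qed

end
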